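(* Laplacian perfect pair state transfer can be achieved in a cycle with at least six vertices by inserting exactly two suitable edges. That is, for every $n\ge 6$ there exist two edges, not in the cycle $C_n$, whose addition to $C_n$ yields a (simple, unweighted) graph that exhibits perfect pair state transfer with respect to its Laplacian matrix.
   Context: $C_n$ is the cycle on $n$ vertices. For a graph with adjacency matrix $A$ and diagonal degree matrix $\Delta$, the Laplacian is $L=\Delta-A$. A pair state is a vector $\frac{1}{\sqrt2}(\mathbf{e}_a-\mathbf{e}_b)$ with $a\ne b$ vertices, where $\mathbf{e}_a$ is the characteristic vector of $a$. Perfect pair state transfer with respect to $L$ means there are two linearly independent pair states $\mathbf{x},\mathbf{y}$, some $\tau>0$ and $\gamma\in\mathbb{C}$ with $\exp(i\tau L)\mathbf{x}=\gamma\mathbf{y}$. *)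

theory Defs
  imports Complex_Main "Jordan_Normal_Form.Jordan_Normal_Form" "Jordan_Normal_Form.VS_Connect"
begin

text \<open>A graph on the vertex set \<open>{..<n}\<close> is given by its set of edges, each a two-element
  set of vertices.\<close>

definition all_edges :: "nat \<Rightarrow> nat set set" where
  "all_edges n = {{u, v} | u v. u < n \<and> v < n \<and> u \<noteq> v}"

definition simple_graph :: "nat \<Rightarrow> nat set set \<Rightarrow> bool" where
  "simple_graph n E \<longleftrightarrow> E \<subseteq> all_edges n"

text \<open>For \<open>n \<ge> 3\<close> this is the cycle on \<open>n\<close> vertices; for \<open>n < 3\<close> it is not meaningful.\<close>

definition cycle_edges :: "nat \<Rightarrow> nat set set" where
  "cycle_edges n = {{i, Suc i mod n} | i. i < n}"

definition vertex_degree :: "nat set set \<Rightarrow> nat \<Rightarrow> nat" where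
  "vertex_degree E v = card {e \<in> E. v \<in> e}"

definition adjacency_matrix :: "nat \<Rightarrow> nat set set \<Rightarrow> complex mat" where
  "adjacency_matrix n E = mat n n (\<lambda>(u, v). if {u, v} \<in> E then 1 else 0)"

definition degree_matrix :: "nat \<Rightarrow> nat set set \<Rightarrow> complex mat" where
  "degree_matrix n E = mat_diag n (\<lambda>v. of_nat (vertex_degree E v))"

definition laplacian :: "nat \<Rightarrow> nat set set \<Rightarrow> complex mat" where
  "laplacian n E = degree_matrix n E - adjacency_matrix n E"

text \<open>The exponential of a square matrix, as the entrywise sum of the power series. The series
  converges for every square matrix, see \<open>mat_exp_summable\<close> below.\<close>

definition mat_exp :: "complex mat \<Rightarrow> complex mat" where
  "mat_exp A = mat (dim_row A) (dim_row A) (\<lambda>(i, j). \<Sum>k. (A ^\<^sub>m k) $$ (i, j) / fact k)"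

lemma mat_exp_summable:
  assumes A: "A \<in> carrier_mat n n" and ij: "i < n" "j < n"
  shows "summable (\<lambda>k. (A ^\<^sub>m k) $$ (i, j) / (fact k :: complex))"
proof -
  obtain b where b: "norm_bound A b"
    using norm_bound_max by blast
  define c where "c = 1 + \<bar>b\<bar> * of_nat n"
  have pow: "A ^\<^sub>m k \<in> carrier_mat n n" for k
    using A by simp
  have "norm_bound (A ^\<^sub>m k) (c ^ k)" for k
  proof (induction k)
    case 0
    show ?case using A by (auto simp: norm_bound_def one_mat_def)
  next
    case (Suc k)
    have "norm_bound (A ^\<^sub>m k * A) (c ^ k * b * of_nat n)"
      by (rule norm_bound_mult[OF pow A Suc b])
    moreover have "c ^ k * b * of_nat n \<le> c ^ Suc k"
    proof -
      have "b * of_nat n \<le> \<bar>b\<bar> * of_nat n"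
        by (intro mult_right_mono) auto
      hence "b * of_nat n \<le> c" by (simp add: c_def)
      moreover have "0 \<le> c ^ k" by (simp add: c_def)
      ultimately have "c ^ k * (b * of_nat n) \<le> c ^ k * c"
        by (rule mult_left_mono)
      thus ?thesis by (simp add: mult_ac)
    qed
    ultimately show ?case
      unfolding norm_bound_def by (auto intro: order_trans)
  qed
  hence le: "norm ((A ^\<^sub>m k) $$ (i, j)) \<le> c ^ k" for k
    using A ij unfolding norm_bound_def by (simp add: carrier_matD split: if_splits)
  show ?thesis
  proof (rule summable_comparison_test)
    show "\<exists>N. \<forall>k\<ge>N. norm ((A ^\<^sub>m k) $$ (i, j) / (fact k :: complex)) \<le> inverse (fact k) * c ^ k"
      using le by (auto simp: norm_divide field_simps intro!: divide_right_mono)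
    show "summable (\<lambda>k. inverse (fact k) * c ^ k)"
      by (rule summable_exp)
  qed
qed

definition pair_state :: "nat \<Rightarrow> nat \<Rightarrow> nat \<Rightarrow> complex vec" where
  "pair_state n a b = complex_of_real (1 / sqrt 2) \<cdot>\<^sub>v (unit_vec n a - unit_vec n b)"

definition is_pair_state :: "nat \<Rightarrow> complex vec \<Rightarrow> bool" where
  "is_pair_state n x \<longleftrightarrow> (\<exists>a<n. \<exists>b<n. a \<noteq> b \<and> x = pair_state n a b)"

lemma lin_indpt_pair_iff:
  fixes x y :: "complex vec"
  assumes x: "x \<in> carrier_vec n" and y: "y \<in> carrier_vec n" and "x \<noteq> y"
  shows "\<not> module.lin_dep class_ring (module_vec TYPE(complex) n) {x, y} \<longleftrightarrow>
    (\<forall>c d. c \<cdot>\<^sub>v x + d \<cdot>\<^sub>v y = 0\<^sub>v n \<longrightarrow> c = 0 \<and> d = 0)"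
proof -
  interpret vec_space "TYPE(complex)" n .
  have comb: "lincomb a {x, y} = a x \<cdot>\<^sub>v x + a y \<cdot>\<^sub>v y" for a
  proof -
    have "lincomb a {x, y} = a x \<cdot>\<^sub>v x + lincomb a {y}"
      using lincomb_insert2[of "{y}" a x] x y \<open>x \<noteq> y\<close> by simp
    also have "lincomb a {y} = a y \<cdot>\<^sub>v y + lincomb a {}"
      using lincomb_insert2[of "{}" a y] y by simp
    also have "lincomb a {} = 0\<^sub>v n" by (simp add: lincomb_def)
    finally show ?thesis using y by simp
  qed
  have sub: "{x, y} \<subseteq> carrier_vec n" using x y by auto
  show ?thesis
  proof (intro iffI allI impI)
    fix c d
    assume li: "lin_indpt {x, y}" and eq: "c \<cdot>\<^sub>v x + d \<cdot>\<^sub>v y = 0\<^sub>v n"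
    define a where "a = (\<lambda>v. if v = x then c else d)"
    have lc: "lincomb a {x, y} = 0\<^sub>v n"
      using eq \<open>x \<noteq> y\<close> unfolding comb a_def by simp
    have "a v = 0" if "v \<in> {x, y}" for v
    proof (rule ccontr)
      assume "a v \<noteq> 0"
      with lc that have "lin_dep {x, y}"
        unfolding lin_dep_def
        by (intro exI[of _ "{x, y}"] exI[of _ a] exI[of _ v]) simp
      with li show False ..
    qed
    from this[of x] this[of y] show "c = 0 \<and> d = 0"
      using \<open>x \<noteq> y\<close> unfolding a_def by simp
  next
    assume *: "\<forall>c d. c \<cdot>\<^sub>v x + d \<cdot>\<^sub>v y = 0\<^sub>v n \<longrightarrow> c = 0 \<and> d = 0"
    show "lin_indpt {x, y}"
    proof
      assume "lin_dep {x, y}"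
      then obtain a v where a: "lincomb a {x, y} = 0\<^sub>v n" "v \<in> {x, y}" "a v \<noteq> 0"
        using finite_lin_dep[of "{x, y}"] sub by auto
      from * a(1) have "a x = 0 \<and> a y = 0" unfolding comb by blast
      with a(2,3) show False by auto
    qed
  qed
qed

text \<open>\<open>lin_dep\<close> is a property of sets, so linear independence of the two vectors \<open>x\<close> and \<open>y\<close>
  additionally requires \<open>x \<noteq> y\<close>.\<close>

definition perfect_pair_state_transfer :: "nat \<Rightarrow> complex mat \<Rightarrow> bool" where
  "perfect_pair_state_transfer n L \<longleftrightarrow>
     (\<exists>x y. is_pair_state n x \<and> is_pair_state n y \<and>
        x \<noteq> y \<and> \<not> module.lin_dep class_ring (module_vec TYPE(complex) n) {x, y} \<and>
        (\<exists>\<tau>::real. \<tau> > 0 \<and>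
           (\<exists>\<gamma>::complex. mat_exp ((\<i> * complex_of_real \<tau>) \<cdot>\<^sub>m L) *\<^sub>v x = \<gamma> \<cdot>\<^sub>v y)))"

end

theory Submission
  imports Defs
begin

text \<open>
  The graph comes from \<open>C\<^sub>n\<close> with consecutive vertices \<open>0, 1, 2, 3, 4, 5\<close> by adding the chords
  \<open>{0, 4}\<close> and \<open>{1, 5}\<close>.  Then \<open>1\<close> and \<open>4\<close> have the same neighbours \<open>0, 5\<close> outside \<open>{1, 2, 3, 4}\<close>,
  and \<open>2\<close> and \<open>3\<close> have none, so swapping \<open>1\<close> with \<open>4\<close> and \<open>2\<close> with \<open>3\<close> while fixing every other
  vertex is an automorphism, whatever the length of the rest of the cycle.  The vectors which this
  automorphism negates form the plane spanned by \<open>u = e\<^sub>1 - e\<^sub>4\<close> and \<open>w = e\<^sub>2 - e\<^sub>3\<close>, and the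
  Laplacian preserves it: \<open>L u = 3 u - w\<close> and \<open>L w = 3 w - u\<close>.

  On such a plane a matrix exponential is explicit (\<open>mat_exp_symmetric_plane\<close>), because \<open>u + w\<close> and
  \<open>u - w\<close> are eigenvectors, here with eigenvalues \<open>2\<close> and \<open>4\<close>.  At time \<open>\<pi> / 2\<close> the first is
  multiplied by \<open>exp (\<i> * \<pi>) = -1\<close> and the second by \<open>exp (2 * \<i> * \<pi>) = 1\<close>, which sends \<open>u\<close> to
  \<open>-w\<close>.
\<close>

section \<open>The matrix exponential on an invariant plane\<close>

lemma pow_mat_mult_eigenvector:
  fixes A :: "complex mat"
  assumes A: "A \<in> carrier_mat n n" and v: "v \<in> carrier_vec n" and eq: "A *\<^sub>v v = l \<cdot>\<^sub>v v"
  shows "(A ^\<^sub>m k) *\<^sub>v v = l ^ k \<cdot>\<^sub>v v"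
proof (induction k)
  case 0
  show ?case using A v by simp
next
  case (Suc k)
  have "(A ^\<^sub>m Suc k) *\<^sub>v v = (A ^\<^sub>m k) *\<^sub>v (A *\<^sub>v v)"
    using A v by (simp add: assoc_mult_mat_vec[of _ n n])
  also have "\<dots> = l \<cdot>\<^sub>v ((A ^\<^sub>m k) *\<^sub>v v)"
    unfolding eq using A v by (intro mult_mat_vec[of _ n n]) auto
  also have "\<dots> = l ^ Suc k \<cdot>\<^sub>v v"
    by (simp add: Suc smult_smult_assoc)
  finally show ?case .
qed

lemma mat_exp_carrier: "A \<in> carrier_mat n n \<Longrightarrow> mat_exp A \<in> carrier_mat n n"
  by (simp add: mat_exp_def)

lemma mat_exp_mult_eigenvector:
  fixes A :: "complex mat"
  assumes A: "A \<in> carrier_mat n n" and v: "v \<in> carrier_vec n" and eq: "A *\<^sub>v v = l \<cdot>\<^sub>v v"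
  shows "mat_exp A *\<^sub>v v = exp l \<cdot>\<^sub>v v"
proof (rule eq_vecI)
  show "dim_vec (mat_exp A *\<^sub>v v) = dim_vec (exp l \<cdot>\<^sub>v v)"
    using A v by (simp add: mat_exp_def)
next
  fix i assume "i < dim_vec (exp l \<cdot>\<^sub>v v)"
  hence i: "i < n" using v by simp
  have pow: "A ^\<^sub>m k \<in> carrier_mat n n" for k
    using A by simp
  let ?t = "\<lambda>k j. (A ^\<^sub>m k) $$ (i, j) / fact k * v $ j"
  have row: "(\<Sum>j<n. ?t k j) = l ^ k / fact k * v $ i" for k
  proof -
    have "(\<Sum>j<n. ?t k j) = (\<Sum>j<n. (A ^\<^sub>m k) $$ (i, j) * v $ j) / fact k"
      by (simp add: sum_divide_distrib)
    also have "(\<Sum>j<n. (A ^\<^sub>m k) $$ (i, j) * v $ j) = ((A ^\<^sub>m k) *\<^sub>v v) $ i"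
      using carrier_matD[OF pow[of k]] v i by (simp add: scalar_prod_def lessThan_atLeast0)
    finally show ?thesis
      using pow_mat_mult_eigenvector[OF A v eq, of k] v i by simp
  qed
  have "(mat_exp A *\<^sub>v v) $ i = (\<Sum>j<n. (\<Sum>k. (A ^\<^sub>m k) $$ (i, j) / fact k) * v $ j)"
    using A v i by (simp add: mat_exp_def scalar_prod_def lessThan_atLeast0)
  also have "\<dots> = (\<Sum>j<n. \<Sum>k. ?t k j)"
    using mat_exp_summable[OF A i] by (intro sum.cong refl suminf_mult2) auto
  also have "\<dots> = (\<Sum>k. \<Sum>j<n. ?t k j)"
    using mat_exp_summable[OF A i] by (intro suminf_sum[symmetric] summable_mult2) auto
  also have "\<dots> = (\<Sum>k. l ^ k / fact k * v $ i)"
    by (simp only: row)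
  also have "\<dots> = exp l * v $ i"
  proof -
    have "(\<lambda>k. l ^ k / fact k) sums exp l"
      using exp_converges[of l] by (simp add: scaleR_conv_of_real field_simps)
    from sums_mult2[OF this, of "v $ i"] show ?thesis
      by (simp add: sums_iff)
  qed
  finally show "(mat_exp A *\<^sub>v v) $ i = (exp l \<cdot>\<^sub>v v) $ i"
    using v i by simp
qed

text \<open>The vectors \<open>u + w\<close> and \<open>u - w\<close> are eigenvectors for \<open>p + q\<close> and \<open>p - q\<close>, and \<open>u\<close> is half of
  their sum.\<close>

lemma mat_exp_symmetric_plane:
  fixes A :: "complex mat"
  assumes A: "A \<in> carrier_mat n n" and u: "u \<in> carrier_vec n" and w: "w \<in> carrier_vec n"
    and Au: "A *\<^sub>v u = p \<cdot>\<^sub>v u + q \<cdot>\<^sub>v w" and Aw: "A *\<^sub>v w = q \<cdot>\<^sub>v u + p \<cdot>\<^sub>v w"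
  shows "mat_exp (z \<cdot>\<^sub>m A) *\<^sub>v u =
    ((exp (z * (p + q)) + exp (z * (p - q))) / 2) \<cdot>\<^sub>v u +
    ((exp (z * (p + q)) - exp (z * (p - q))) / 2) \<cdot>\<^sub>v w"
proof -
  have zA: "z \<cdot>\<^sub>m A \<in> carrier_mat n n" using A by simp
  have E: "mat_exp (z \<cdot>\<^sub>m A) \<in> carrier_mat n n"
    using zA by (rule mat_exp_carrier)
  have smult: "(z \<cdot>\<^sub>m A) *\<^sub>v v = z \<cdot>\<^sub>v (A *\<^sub>v v)" if "v \<in> carrier_vec n" for v
    using A that by (intro eq_vecI) auto
  have "A *\<^sub>v (u + w) = (p + q) \<cdot>\<^sub>v (u + w)"
    using mult_add_distrib_mat_vec[OF A u w] u w Au Aw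
    by (intro eq_vecI) (auto simp: algebra_simps)
  hence "(z \<cdot>\<^sub>m A) *\<^sub>v (u + w) = (z * (p + q)) \<cdot>\<^sub>v (u + w)"
    using u w by (simp add: smult smult_smult_assoc)
  from mat_exp_mult_eigenvector[OF zA _ this]
  have plus: "mat_exp (z \<cdot>\<^sub>m A) *\<^sub>v (u + w) = exp (z * (p + q)) \<cdot>\<^sub>v (u + w)"
    using u w by simp
  have "A *\<^sub>v (u - w) = (p - q) \<cdot>\<^sub>v (u - w)"
    using mult_minus_distrib_mat_vec[OF A u w] u w Au Aw
    by (intro eq_vecI) (auto simp: algebra_simps)
  hence "(z \<cdot>\<^sub>m A) *\<^sub>v (u - w) = (z * (p - q)) \<cdot>\<^sub>v (u - w)"
    using u w by (simp add: smult smult_smult_assoc)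
  from mat_exp_mult_eigenvector[OF zA _ this]
  have minus: "mat_exp (z \<cdot>\<^sub>m A) *\<^sub>v (u - w) = exp (z * (p - q)) \<cdot>\<^sub>v (u - w)"
    using u w by simp
  have "u = (1 / 2) \<cdot>\<^sub>v ((u + w) + (u - w))"
    using u w by (intro eq_vecI) auto
  hence "mat_exp (z \<cdot>\<^sub>m A) *\<^sub>v u = mat_exp (z \<cdot>\<^sub>m A) *\<^sub>v ((1 / 2) \<cdot>\<^sub>v ((u + w) + (u - w)))"
    by (rule arg_cong)
  also have "\<dots> = (1 / 2) \<cdot>\<^sub>v (exp (z * (p + q)) \<cdot>\<^sub>v (u + w) + exp (z * (p - q)) \<cdot>\<^sub>v (u - w))"
    using mult_add_distrib_mat_vec[OF E, of "u + w" "u - w"] u w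
    by (simp add: mult_mat_vec[OF E] plus minus)
  also have "\<dots> = ((exp (z * (p + q)) + exp (z * (p - q))) / 2) \<cdot>\<^sub>v u +
    ((exp (z * (p + q)) - exp (z * (p - q))) / 2) \<cdot>\<^sub>v w"
    using u w by (intro eq_vecI) (auto simp: field_simps)
  finally show ?thesis .
qed

section \<open>Columns of the Laplacian\<close>

lemma laplacian_carrier: "laplacian n E \<in> carrier_mat n n"
  unfolding laplacian_def adjacency_matrix_def by (intro minus_carrier_mat) simp

lemma vertex_degree_eq_card_neighbours:
  assumes "simple_graph n E"
  shows "vertex_degree E v = card {k. {v, k} \<in> E}"
proof -
  have "bij_betw (\<lambda>k. {v, k}) {k. {v, k} \<in> E} {e \<in> E. v \<in> e}"
    using assms unfolding bij_betw_def inj_on_def simple_graph_def all_edges_def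
    by (fastforce simp: doubleton_eq_iff insert_commute image_iff)
  thus ?thesis
    by (simp add: vertex_degree_def bij_betw_same_card)
qed

lemma laplacian_mult_unit_vec:
  assumes E: "simple_graph n E" and v: "v < n"
  shows "laplacian n E *\<^sub>v unit_vec n v =
    vec n (\<lambda>i. if i = v then of_nat (card {k. {v, k} \<in> E}) else if {v, i} \<in> E then -1 else 0)"
proof -
  have "{v} \<notin> E"
    using E by (auto simp: simple_graph_def all_edges_def)
  thus ?thesis
    using v laplacian_carrier[of n E]
    by (intro eq_vecI)
      (auto simp: laplacian_def degree_matrix_def adjacency_matrix_def mat_diag_def
        vertex_degree_eq_card_neighbours[OF E] insert_commute)
qed

section \<open>A cycle with two crossing chords\<close>

lemma cycle_edges_subset_all_edges:
  assumes "n \<ge> 2"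
  shows "cycle_edges n \<subseteq> all_edges n"
proof
  fix e assume "e \<in> cycle_edges n"
  then obtain i where "i < n" "e = {i, Suc i mod n}"
    by (auto simp: cycle_edges_def)
  moreover have "i \<noteq> Suc i mod n"
    using assms \<open>i < n\<close> by (cases "Suc i = n") auto
  ultimately show "e \<in> all_edges n"
    unfolding all_edges_def using assms by fastforce
qed

lemma cycle_edges_neighbour_iff:
  assumes "0 < v" "Suc v < n"
  shows "{v, k} \<in> cycle_edges n \<longleftrightarrow> Suc k = v \<or> k = Suc v"
proof
  assume "{v, k} \<in> cycle_edges n"
  then obtain i where "i < n" "{v, k} = {i, Suc i mod n}"
    by (auto simp: cycle_edges_def)
  thus "Suc k = v \<or> k = Suc v"
    using assms by (cases "Suc i = n") (auto simp: doubleton_eq_iff)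
next
  assume "Suc k = v \<or> k = Suc v"
  thus "{v, k} \<in> cycle_edges n"
  proof
    assume "Suc k = v"
    with assms show ?thesis
      by (auto simp: cycle_edges_def insert_commute intro!: exI[of _ k])
  next
    assume "k = Suc v"
    with assms show ?thesis
      by (auto simp: cycle_edges_def intro!: exI[of _ v])
  qed
qed

text \<open>In the difference of the columns of \<open>1\<close> and \<open>4\<close> their common neighbours \<open>0\<close> and \<open>5\<close> cancel;
  this is what confines the image to the span of the two pair states.  The diagonal entries of the
  two identities agree because the edge \<open>{2, 3}\<close> lies inside a swapped pair: an antisymmetric
  vector changes sign along it, so it contributes \<open>1\<close> to the degree \<open>2\<close>.\<close>

lemma laplacian_crossed_cycle:
  assumes n: "n \<ge> 6" and E: "E = cycle_edges n \<union> {{0, 4}, {1, 5}}"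
  shows "simple_graph n E"
    and "laplacian n E *\<^sub>v (unit_vec n 1 - unit_vec n 4) =
      3 \<cdot>\<^sub>v (unit_vec n 1 - unit_vec n 4) + (-1) \<cdot>\<^sub>v (unit_vec n 2 - unit_vec n 3)"
    and "laplacian n E *\<^sub>v (unit_vec n 2 - unit_vec n 3) =
      (-1) \<cdot>\<^sub>v (unit_vec n 1 - unit_vec n 4) + 3 \<cdot>\<^sub>v (unit_vec n 2 - unit_vec n 3)"
proof -
  have "{0, 4} \<in> all_edges n" "{1, 5} \<in> all_edges n"
    unfolding all_edges_def using n by fastforce+
  with cycle_edges_subset_all_edges[of n] n show simple: "simple_graph n E"
    by (auto simp: simple_graph_def E)
  have nb: "{1, k} \<in> E \<longleftrightarrow> k \<in> {0, 2, 5}" "{2, k} \<in> E \<longleftrightarrow> k \<in> {1, 3}"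
    "{3, k} \<in> E \<longleftrightarrow> k \<in> {2, 4}" "{4, k} \<in> E \<longleftrightarrow> k \<in> {0, 3, 5}" for k
    using n cycle_edges_neighbour_iff[of 1 n k] cycle_edges_neighbour_iff[of 2 n k]
      cycle_edges_neighbour_iff[of 3 n k] cycle_edges_neighbour_iff[of 4 n k]
    by (auto simp: E doubleton_eq_iff)
  have col:
    "laplacian n E *\<^sub>v unit_vec n 1 = vec n (\<lambda>i. if i = 1 then 3 else if i \<in> {0, 2, 5} then -1 else 0)"
    "laplacian n E *\<^sub>v unit_vec n 2 = vec n (\<lambda>i. if i = 2 then 2 else if i \<in> {1, 3} then -1 else 0)"
    "laplacian n E *\<^sub>v unit_vec n 3 = vec n (\<lambda>i. if i = 3 then 2 else if i \<in> {2, 4} then -1 else 0)"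
    "laplacian n E *\<^sub>v unit_vec n 4 = vec n (\<lambda>i. if i = 4 then 3 else if i \<in> {0, 3, 5} then -1 else 0)"
    using n laplacian_mult_unit_vec[OF simple, of 1] laplacian_mult_unit_vec[OF simple, of 2]
      laplacian_mult_unit_vec[OF simple, of 3] laplacian_mult_unit_vec[OF simple, of 4]
    by (simp_all only: nb Collect_mem_eq) (simp_all cong: if_cong)
  have diff: "laplacian n E *\<^sub>v (unit_vec n a - unit_vec n b) =
      laplacian n E *\<^sub>v unit_vec n a - laplacian n E *\<^sub>v unit_vec n b" for a b
    by (rule mult_minus_distrib_mat_vec[OF laplacian_carrier]) auto
  show "laplacian n E *\<^sub>v (unit_vec n 1 - unit_vec n 4) =
      3 \<cdot>\<^sub>v (unit_vec n 1 - unit_vec n 4) + (-1) \<cdot>\<^sub>v (unit_vec n 2 - unit_vec n 3)"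
    unfolding diff col using n by (intro eq_vecI) (auto simp: unit_vec_def)
  show "laplacian n E *\<^sub>v (unit_vec n 2 - unit_vec n 3) =
      (-1) \<cdot>\<^sub>v (unit_vec n 1 - unit_vec n 4) + 3 \<cdot>\<^sub>v (unit_vec n 2 - unit_vec n 3)"
    unfolding diff col using n by (intro eq_vecI) (auto simp: unit_vec_def)
qed

section \<open>Pair state transfer\<close>

lemma pair_state_carrier [simp]: "pair_state n a b \<in> carrier_vec n"
  by (simp add: pair_state_def)

lemma pair_state_index:
  assumes "i < n"
  shows "pair_state n a b $ i = complex_of_real (1 / sqrt 2) * (of_bool (i = a) - of_bool (i = b))"
  using assms by (simp add: pair_state_def unit_vec_def)

lemma pair_states_disjoint_independent:
  assumes lt: "a < n" "c < n" and ne: "a \<noteq> b" "c \<noteq> d" "a \<notin> {c, d}" "c \<notin> {a, b}"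
  shows "pair_state n a b \<noteq> pair_state n c d"
    and "\<not> module.lin_dep class_ring (module_vec TYPE(complex) n) {pair_state n a b, pair_state n c d}"
proof -
  have "pair_state n a b $ a \<noteq> pair_state n c d $ a"
    using assms by (simp add: pair_state_index)
  thus neq: "pair_state n a b \<noteq> pair_state n c d" by metis
  have "s = 0 \<and> t = 0"
    if eq: "s \<cdot>\<^sub>v pair_state n a b + t \<cdot>\<^sub>v pair_state n c d = 0\<^sub>v n" for s t
  proof -
    have "s * pair_state n a b $ i + t * pair_state n c d $ i = 0" if "i < n" for i
      using arg_cong[OF eq, of "\<lambda>v. v $ i"] that pair_state_carrier[of n a b] pair_state_carrier[of n c d]
      by (simp del: pair_state_carrier)
    from this[of a] this[of c] show ?thesis
      using assms by (auto simp: pair_state_index)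
  qed
  thus "\<not> module.lin_dep class_ring (module_vec TYPE(complex) n) {pair_state n a b, pair_state n c d}"
    using neq by (subst lin_indpt_pair_iff) auto
qed

theorem theorem6:
  fixes n :: nat
  assumes "n \<ge> 6"
  shows "\<exists>e f. e \<in> all_edges n \<and> f \<in> all_edges n \<and> e \<noteq> f \<and>
           e \<notin> cycle_edges n \<and> f \<notin> cycle_edges n \<and>
           simple_graph n (cycle_edges n \<union> {e, f}) \<and>
           perfect_pair_state_transfer n (laplacian n (cycle_edges n \<union> {e, f}))"
proof -
  define E where "E = cycle_edges n \<union> {{0, 4}, {1, 5}}"
  define L where "L = laplacian n E"
  define u w :: "complex vec" where "u = unit_vec n 1 - unit_vec n 4" and "w = unit_vec n 2 - unit_vec n 3"
  define r where "r = complex_of_real (1 / sqrt 2)"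
  define z where "z = \<i> * complex_of_real (pi / 2)"
  note crossed = laplacian_crossed_cycle[OF assms E_def]
  have L: "L \<in> carrier_mat n n" by (simp add: L_def laplacian_carrier)
  have uw [simp]: "u \<in> carrier_vec n" "w \<in> carrier_vec n" by (simp_all add: u_def w_def)
  have states: "pair_state n 1 4 = r \<cdot>\<^sub>v u" "pair_state n 2 3 = r \<cdot>\<^sub>v w"
    by (simp_all add: pair_state_def u_def w_def r_def)
  have "z * (3 + - 1) = \<i> * pi" "z * (3 - - 1) = 2 * complex_of_real pi * \<i>"
    by (simp_all add: z_def)
  hence exps: "exp (z * (3 + - 1)) = -1" "exp (z * (3 - - 1)) = 1"
    by (simp_all only: exp_pi_i' exp_two_pi_i)
  have E: "mat_exp (z \<cdot>\<^sub>m L) \<in> carrier_mat n n"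
    using L by (intro mat_exp_carrier) simp
  have "mat_exp (z \<cdot>\<^sub>m L) *\<^sub>v u = (-1) \<cdot>\<^sub>v w"
    using mat_exp_symmetric_plane[OF L _ _ crossed(2,3)[folded L_def u_def w_def], of z]
    unfolding exps by (auto simp: carrier_vecD[OF uw(1)] carrier_vecD[OF uw(2)] intro!: eq_vecI)
  hence "mat_exp (z \<cdot>\<^sub>m L) *\<^sub>v pair_state n 1 4 = (-1) \<cdot>\<^sub>v pair_state n 2 3"
    unfolding states by (simp add: mult_mat_vec[OF E] smult_smult_assoc)
  moreover have "is_pair_state n (pair_state n 1 4)"
    unfolding is_pair_state_def by (rule exI[of _ 1], use assms in \<open>auto intro!: exI[of _ 4]\<close>)
  moreover have "is_pair_state n (pair_state n 2 3)"
    unfolding is_pair_state_def by (rule exI[of _ 2], use assms in \<open>auto intro!: exI[of _ 3]\<close>)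
  moreover have "pair_state n 1 4 \<noteq> pair_state n 2 3"
    "\<not> module.lin_dep class_ring (module_vec TYPE(complex) n) {pair_state n 1 4, pair_state n 2 3}"
    using assms by (intro pair_states_disjoint_independent; simp)+
  ultimately have "perfect_pair_state_transfer n L"
    unfolding perfect_pair_state_transfer_def z_def using pi_half_gt_zero by blast
  moreover have "{0, 4} \<notin> cycle_edges n" "{1, 5} \<notin> cycle_edges n"
    using cycle_edges_neighbour_iff[of 4 n 0] cycle_edges_neighbour_iff[of 1 n 5] assms
    by (simp_all add: insert_commute)
  moreover have "{0, 4} \<in> all_edges n" "{1, 5} \<in> all_edges n" "{0, 4} \<noteq> {1, 5 :: nat}"
    using crossed(1) by (auto simp: simple_graph_def E_def)
  ultimately show ?thesis
    using crossed(1) unfolding L_def E_def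
    by (intro exI[of _ "{0, 4}"] exI[of _ "{1, 5}"] conjI)
qed

end
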